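(* For every family $\mathcal{A}$ with $\{F_1,F_2,F_3\}\subseteq\mathcal{A}\subseteq\mathcal{F}=\{F_1,\dots,F_7\}$ (16 choices of $\mathcal{A}$), $\mathrm{ex}(n,\mathcal{A})=\Theta(n^{3/2})$ as $n\to\infty$. In particular, $\mathrm{ex}(n,\mathcal{F})=\Theta(n^{3/2})$.
   Context: A triple system $H=(V,E)$ has a finite vertex set $V$, and $E$ is a set of $3$-element subsets of $V$ (no repeated triples). For a family $\mathcal{H}$ of triple systems, $\mathrm{ex}(n,\mathcal{H})$ is the maximum number of triples in a triple system on $n$ vertices that does not contain (an isomorphic copy of) any member of $\mathcal{H}$ as a (not necessarily induced) subsystem. A special four cycle has four distinct base vertices $v_1,v_2,v_3,v_4$ and four triples $\{w_i,v_i,v_{i+1}\}$, $i=1,2,3,4$ (indices modulo $4$), where the $w_j$ are not necessarily distinct but $w_i\neq v_j$ for all $1\le i,j\le 4$. Up to isomorphism there are seven, forming $\mathcal{F}=\{F_1,\dots,F_7\}$, given by exactly the following coincidences among the $w_j$ (no other coincidences): $F_1$: all $w_j$ different; $F_2$: $w_1=w_2=w_3=w_4$; $F_3$: $w_1=w_2$ and $w_3=w_4$; $F_4$: $w_1=w_3$ and $w_2=w_4$ (the Pasch configuration); $F_5$: $w_1=w_2=w_3$; $F_6$: $w_1=w_3$; $F_7$: $w_1=w_2$. *)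

theory Defs
  imports Complex_Main "HOL-Library.Landau_Symbols"
begin

type_synonym 'a hypergraph = "'a set \<times> 'a set set"

definition triple_system :: "'a hypergraph \<Rightarrow> bool" where
  "triple_system H \<longleftrightarrow>
     finite (fst H) \<and> (\<forall>e \<in> snd H. e \<subseteq> fst H \<and> card e = 3)"

text \<open>Not necessarily induced: triples of \<open>H\<close> inside the copy of \<open>G\<close> that are not
  images of triples of \<open>G\<close> are allowed.\<close>

definition contains_copy :: "'a hypergraph \<Rightarrow> 'b hypergraph \<Rightarrow> bool" where
  "contains_copy H G \<longleftrightarrow>
     (\<exists>f. inj_on f (fst G) \<and> f ` fst G \<subseteq> fst H \<and> (\<forall>e \<in> snd G. f ` e \<in> snd H))"

text \<open>Every finite triple system is isomorphic to one whose vertices are natural numbers,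
  so it suffices to range over these. At most \<open>n choose 3\<close> triples fit on \<open>n\<close> vertices, so
  the set of sizes is finite; it contains \<open>0\<close> whenever every member of \<open>A\<close> has a triple.\<close>

definition ex :: "nat \<Rightarrow> 'b hypergraph set \<Rightarrow> nat" where
  "ex n A = Max {card (snd H) | H :: nat hypergraph.
     triple_system H \<and> card (fst H) = n \<and> (\<forall>G \<in> A. \<not> contains_copy H G)}"

text \<open>The special four cycle with base vertices \<open>0, 1, 2, 3\<close> and further vertices \<open>w1\<close> to
  \<open>w4\<close>, which must all be at least \<open>4\<close>.\<close>

definition special_four_cycle :: "nat \<Rightarrow> nat \<Rightarrow> nat \<Rightarrow> nat \<Rightarrow> nat hypergraph" where
  "special_four_cycle w1 w2 w3 w4 =
     ({0, 1, 2, 3} \<union> {w1, w2, w3, w4}, {{w1, 0, 1}, {w2, 1, 2}, {w3, 2, 3}, {w4, 3, 0}})"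

definition F1 :: "nat hypergraph" where "F1 = special_four_cycle 4 5 6 7"
definition F2 :: "nat hypergraph" where "F2 = special_four_cycle 4 4 4 4"
definition F3 :: "nat hypergraph" where "F3 = special_four_cycle 4 4 5 5"
definition F4 :: "nat hypergraph" where "F4 = special_four_cycle 4 5 4 5"
definition F5 :: "nat hypergraph" where "F5 = special_four_cycle 4 4 4 5"
definition F6 :: "nat hypergraph" where "F6 = special_four_cycle 4 5 4 6"
definition F7 :: "nat hypergraph" where "F7 = special_four_cycle 4 4 5 6"

definition special_four_cycles :: "nat hypergraph set" where
  "special_four_cycles = {F1, F2, F3, F4, F5, F6, F7}"

end

theory Submission
  imports Defs "HOL-Algebra.Algebraic_Closure_Type" "HOL-Analysis.Convex"
begin

text \<open>
  The order of magnitude \<open>n powr (3 / 2)\<close> is that of graphs without a four cycle, and both bounds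
  reduce to graphs.

  Lower bound. Take a graph without a four cycle and turn every edge into a triple by adding one
  and the same new vertex, the apex. A base vertex of a special four cycle lies in only two of its
  four triples, while the apex lies in all of them; so the apex is every \<open>w\<^sub>i\<close> and the base is a
  four cycle of the graph. Hence the cone contains none of the seven configurations
  (\<open>cone_no_special_four_cycle\<close>). The point-line incidence graph of the affine plane over a field
  with \<open>q\<close> elements, vertical lines omitted, has \<open>2 q\<^sup>2\<close> vertices and \<open>q\<^sup>3\<close> edges. Powers of two are dense
  enough among the possible \<open>q\<close>, and the field with \<open>2 ^ k\<close> elements is the set of roots of
  \<open>x ^ q - x\<close> in an algebraic closure of the field with two elements.

  Upper bound. Let the system avoid \<open>F1\<close>, \<open>F2\<close> and \<open>F3\<close>. If all pairs covered by a subsystem had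
  codegree at least 6, the four pairs around two triples \<open>x y z\<close> and \<open>x y z'\<close> could be completed
  greedily to a copy of \<open>F1\<close>. Removing low-codegree pairs one after the other therefore assigns to
  each triple one of its pairs, with at most five triples for each pair (\<open>exists_own_pairs\<close>). For a suitable
  vertex set \<open>U\<close>, an eighth of the triples have their own pair inside \<open>U\<close> and the third vertex outside
  (\<open>exists_separating_set\<close>). So up to a constant factor the triples are the edges of a graph on \<open>U\<close>,
  labelled by vertices outside \<open>U\<close>, and a four cycle in this graph is a special four cycle whose
  \<open>w\<^sub>i\<close> are the labels.

  In such a graph call a path of length two monochromatic if its two edges carry the same label.
  Excluding \<open>F2\<close> and \<open>F3\<close> means that any two vertices are the ends of at most one monochromatic
  path. Excluding \<open>F1\<close> forces, by Cauchy-Schwarz, quadratically many in \<open>t\<close> of the four cycles on two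
  vertices with \<open>t\<close> common neighbours to contain a monochromatic path (\<open>many_coincidences\<close>). A four
  cycle with a monochromatic path is determined by a path of length two, up to four ways, so if
  there were much more than \<open>n\<^sup>2\<close> paths of length two, there would be more of these four cycles
  than paths. Hence there are \<open>O(n\<^sup>2)\<close> paths of length two, and by Cauchy-Schwarz again
  \<open>O(n powr (3 / 2))\<close> edges (\<open>labelled_graph_bound\<close>).
\<close>

section \<open>Special four cycles and the extremal number\<close>

text \<open>Without finiteness the \<open>Max\<close> in \<open>ex\<close> would be unspecified.\<close>
lemma finite_ex_sizes:
  "finite {card (snd H) | H :: nat hypergraph.
     triple_system H \<and> card (fst H) = n \<and> (\<forall>G \<in> A. \<not> contains_copy H G)}"
proof (rule finite_subset)
  show "{card (snd H) | H :: nat hypergraph.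
     triple_system H \<and> card (fst H) = n \<and> (\<forall>G \<in> A. \<not> contains_copy H G)} \<subseteq> {..2 ^ n}"
  proof safe
    fix V :: "nat set" and E
    assume H: "triple_system (V, E)" "n = card (fst (V, E))"
    then have "finite V" "E \<subseteq> Pow V" by (auto simp: triple_system_def)
    then have "card E \<le> card (Pow V)" by (intro card_mono) auto
    then show "card (snd (V, E)) \<le> 2 ^ card (fst (V, E))"
      using \<open>finite V\<close> by (simp add: card_Pow)
  qed
qed simp

lemma real_ex_leI:
  assumes ne: "\<And>G. G \<in> A \<Longrightarrow> snd G \<noteq> {}"
    and le: "\<And>H :: nat hypergraph. triple_system H \<Longrightarrow> card (fst H) = n \<Longrightarrow>
      (\<And>G. G \<in> A \<Longrightarrow> \<not> contains_copy H G) \<Longrightarrow> real (card (snd H)) \<le> b"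
  shows "real (ex n A) \<le> b"
proof -
  let ?M = "{card (snd H) | H :: nat hypergraph.
     triple_system H \<and> card (fst H) = n \<and> (\<forall>G \<in> A. \<not> contains_copy H G)}"
  have "card (snd ({..<n}, {} :: nat set set)) \<in> ?M"
    using ne by (intro CollectI exI[of _ "({..<n}, {})"]) (auto simp: triple_system_def contains_copy_def)
  then have "ex n A \<in> ?M"
    unfolding ex_def by (intro Max_in finite_ex_sizes) blast
  then show ?thesis using le by auto
qed

lemma card_le_ex:
  fixes H :: "nat hypergraph"
  assumes "triple_system H" "card (fst H) = n" "\<And>G. G \<in> A \<Longrightarrow> \<not> contains_copy H G"
  shows "card (snd H) \<le> ex n A"
  unfolding ex_def using assms by (intro Max_ge finite_ex_sizes) blast

lemma special_four_cyclesE: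
  assumes "G \<in> special_four_cycles"
  obtains w1 w2 w3 w4 where "G = special_four_cycle w1 w2 w3 w4"
    "w1 \<ge> 4" "w2 \<ge> 4" "w3 \<ge> 4" "w4 \<ge> 4"
  using assms unfolding special_four_cycles_def F1_def F2_def F3_def F4_def F5_def F6_def F7_def
  by (auto intro: that)

lemma snd_special_four_cycle: "snd (special_four_cycle a b c d) = {{a, 0, 1}, {b, 1, 2}, {c, 2, 3}, {d, 3, 0}}"
  by (simp add: special_four_cycle_def)

lemma fst_special_four_cycle: "fst (special_four_cycle a b c d) = {0, 1, 2, 3, a, b, c, d}"
  by (auto simp: special_four_cycle_def)

lemma contains_copy_listI:
  assumes d: "distinct vs" and V: "fst G = {..<length vs}" "set vs \<subseteq> fst H"
    and E: "\<And>e. e \<in> snd G \<Longrightarrow> (!) vs ` e \<in> snd H"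
  shows "contains_copy H G"
  unfolding contains_copy_def
proof (intro exI conjI ballI)
  show "inj_on ((!) vs) (fst G)" using d V by (simp add: inj_on_nth)
  show "(!) vs ` fst G \<subseteq> fst H" using V by auto
qed (rule E)

text \<open>The labels of a four cycle in a labelled graph decide which configuration arises:
  rainbow, constant, or two pairs of equal labels that are adjacent along the cycle.\<close>
lemma special_four_cycle_copies:
  assumes H: "triple_system H"
    and E: "{w1, v1, v2} \<in> snd H" "{w2, v2, v3} \<in> snd H" "{w3, v3, v4} \<in> snd H" "{w4, v4, v1} \<in> snd H"
    and d: "distinct [v1, v2, v3, v4]"
    and w: "{w1, w2, w3, w4} \<inter> {v1, v2, v3, v4} = {}"
  shows "distinct [w1, w2, w3, w4] \<Longrightarrow> contains_copy H F1"
    and "w1 = w2 \<Longrightarrow> w3 = w4 \<Longrightarrow> w2 = w3 \<Longrightarrow> contains_copy H F2"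
    and "w1 = w2 \<Longrightarrow> w3 = w4 \<Longrightarrow> w2 \<noteq> w3 \<Longrightarrow> contains_copy H F3"
proof -
  have V: "{w1, v1, v2} \<subseteq> fst H" "{w2, v2, v3} \<subseteq> fst H" "{w3, v3, v4} \<subseteq> fst H" "{w4, v4, v1} \<subseteq> fst H"
    using H E by (auto simp: triple_system_def)
  show "contains_copy H F1" if "distinct [w1, w2, w3, w4]"
    by (rule contains_copy_listI[where vs = "[v1, v2, v3, v4, w1, w2, w3, w4]"])
      (use that d w V E in \<open>auto simp: F1_def fst_special_four_cycle snd_special_four_cycle\<close>)
  show "contains_copy H F2" if "w1 = w2" "w3 = w4" "w2 = w3"
    by (rule contains_copy_listI[where vs = "[v1, v2, v3, v4, w1]"])
      (use that d w V E in \<open>auto simp: F2_def fst_special_four_cycle snd_special_four_cycle\<close>)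
  show "contains_copy H F3" if "w1 = w2" "w3 = w4" "w2 \<noteq> w3"
    by (rule contains_copy_listI[where vs = "[v1, v2, v3, v4, w1, w3]"])
      (use that d w V E in \<open>auto simp: F3_def fst_special_four_cycle snd_special_four_cycle\<close>)
qed

text \<open>The \<open>w\<^sub>i\<close> can be read off from a special four cycle, because the pair of base vertices in a
  triple tells which \<open>w\<^sub>i\<close> is the third. This separates the seven configurations.\<close>
lemma special_four_cycle_eq_iff:
  assumes "{a, b, c, d} \<subseteq> {4..}" "{a', b', c', d'} \<subseteq> {4..}"
  shows "special_four_cycle a b c d = special_four_cycle a' b' c' d' \<longleftrightarrow>
    a = a' \<and> b = b' \<and> c = c' \<and> d = d'"
proof
  assume eq: "special_four_cycle a b c d = special_four_cycle a' b' c' d'"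
  have third: "x = a" if "{x, i, j} = {a, i, j}" "x \<notin> {i, j}" for x a i j :: nat
    using that by auto
  have ge: "a \<ge> 4" "b \<ge> 4" "c \<ge> 4" "d \<ge> 4" "a' \<ge> 4" "b' \<ge> 4" "c' \<ge> 4" "d' \<ge> 4"
    using assms by auto
  have "{a, 0, 1} \<in> snd (special_four_cycle a' b' c' d')" "{b, 1, 2} \<in> snd (special_four_cycle a' b' c' d')"
    "{c, 2, 3} \<in> snd (special_four_cycle a' b' c' d')" "{d, 3, 0} \<in> snd (special_four_cycle a' b' c' d')"
    unfolding eq[symmetric] by (simp_all add: snd_special_four_cycle)
  moreover have ne: "{w, i, j} \<noteq> {v, k, l}"
    if "\<not> {i, j} \<subseteq> {k, l}" "{i, j, k, l} \<subseteq> {..<4}" "w \<ge> 4" "v \<ge> 4" for w v i j k l :: nat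
  proof
    assume "{w, i, j} = {v, k, l}"
    then have "{i, j} \<subseteq> {v, k, l}" by blast
    then show False using that by auto
  qed
  ultimately have "{a, 0, 1} = {a', 0, 1}" "{b, 1, 2} = {b', 1, 2}" "{c, 2, 3} = {c', 2, 3}" "{d, 3, 0} = {d', 3, 0}"
    using ge by (simp_all add: snd_special_four_cycle ne)
  then show "a = a' \<and> b = b' \<and> c = c' \<and> d = d'"
    using ge third[of a 0 1 a'] third[of b 1 2 b'] third[of c 2 3 c'] third[of d 3 0 d'] by auto
qed simp

text \<open>Exactly \<open>F4\<close> to \<open>F7\<close> can be chosen freely.\<close>
lemma card_subfamilies: "card {A. {F1, F2, F3} \<subseteq> A \<and> A \<subseteq> special_four_cycles} = 16"
proof -
  have d: "distinct [F1, F2, F3, F4, F5, F6, F7]"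
    by (simp add: F1_def F2_def F3_def F4_def F5_def F6_def F7_def special_four_cycle_eq_iff)
  have eq: "{A. {F1, F2, F3} \<subseteq> A \<and> A \<subseteq> special_four_cycles} = (\<union>) {F1, F2, F3} ` Pow {F4, F5, F6, F7}"
    (is "?L = ?R")
  proof
    show "?L \<subseteq> ?R"
    proof
      fix A assume "A \<in> ?L"
      then have "A = {F1, F2, F3} \<union> (A - {F1, F2, F3})" "A - {F1, F2, F3} \<in> Pow {F4, F5, F6, F7}"
        by (auto simp: special_four_cycles_def)
      then show "A \<in> ?R" by blast
    qed
  qed (auto simp: special_four_cycles_def)
  have "inj_on ((\<union>) {F1, F2, F3}) (Pow {F4, F5, F6, F7})"
    by (rule inj_on_inverseI[where g = "\<lambda>A. A - {F1, F2, F3}"]) (use d in auto)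
  then have "card ?L = 2 ^ card {F4, F5, F6, F7}"
    unfolding eq by (subst card_image) (simp_all add: card_Pow)
  also have "card {F4, F5, F6, F7} = 4" using d by simp
  finally show ?thesis by simp
qed

section \<open>A dense incidence structure without four cycles\<close>

lemma CHAR_gf2: "CHAR(gf2) = 2"
proof (rule CHAR_eqI)
  show *: "of_nat 2 = (0 :: gf2)"
  proof -
    have "(1 + 1 :: gf2) = 0"
      by transfer simp
    then show ?thesis by simp
  qed
  show "2 dvd n" if n: "of_nat n = (0 :: gf2)" for n
  proof (rule ccontr)
    assume "\<not> 2 dvd n"
    then obtain m where "n = 2 * m + 1" by (elim oddE)
    then have "of_nat n = (1 :: gf2)"
      using * by simp
    with n show False by simp
  qed
qed

text \<open>The finite field with \<open>q\<close> elements inside an algebraically closed field of prime characteristic.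
  The polynomial \<open>x ^ q - x\<close> has derivative \<open>-1\<close>, so it has \<open>q\<close> different roots, and the roots are
  closed under addition because taking \<open>q\<close>-th powers is additive.\<close>
lemma roots_of_frobenius_power:
  assumes p: "prime CHAR('a)" and q: "q = CHAR('a) ^ k" and k: "k > 0"
  defines "S \<equiv> {x :: 'a :: alg_closed_field. x ^ q = x}"
  shows "finite S" "card S = q"
    "\<And>x y. x \<in> S \<Longrightarrow> y \<in> S \<Longrightarrow> x + y \<in> S" "\<And>x y. x \<in> S \<Longrightarrow> y \<in> S \<Longrightarrow> x * y \<in> S"
proof -
  have q1: "q > 1"
    unfolding q using k prime_gt_1_nat[OF p] by (rule one_less_power[rotated])
  have of_nat_q: "of_nat q = (0 :: 'a)"
    unfolding q using k by (cases k) (auto simp: of_nat_CHAR)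
  define P :: "'a poly" where "P = monom 1 q - monom 1 1"
  have degP: "degree P = q"
    unfolding P_def diff_conv_add_uminus using q1 by (subst degree_add_eq_left) (auto simp: degree_monom_eq)
  have P0: "P \<noteq> 0" using degP q1 by auto
  have S: "S = {x. poly P x = 0}"
    by (auto simp: S_def P_def poly_monom)
  show fin: "finite S"
    unfolding S by (rule poly_roots_finite[OF P0])
  have dP: "pderiv P = - 1"
    by (simp add: P_def pderiv_diff pderiv_monom of_nat_q monom_0 one_pCons)
  have simple_root: "order x P \<le> 1" for x
  proof (rule ccontr)
    assume "\<not> order x P \<le> 1"
    then have "[:-x, 1:] ^ 2 dvd P"
      by (intro order_divides[THEN iffD2]) auto
    then obtain R where "P = [:-x, 1:] * ([:-x, 1:] * R)"
      by (metis dvdE power2_eq_square mult.assoc)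
    then have "poly (pderiv P) x = 0"
      by (simp add: pderiv_mult del: mult_pCons_left)
    then show False by (simp add: dP)
  qed
  obtain A where A: "size A = degree P" "P = smult (lead_coeff P) (\<Prod>x\<in>#A. [:-x, 1:])"
    using alg_closed_imp_factorization[OF P0] by blast
  have "proots P = proots (\<Prod>x\<in>#A. [:-x, 1:])"
    using P0 by (subst A(2)) simp
  also have "\<dots> = A"
  proof (induction A)
    case (add x A)
    have "(\<Prod>x\<in>#A. [:-x, 1:]) \<noteq> 0"
      by (auto simp: prod_mset_zero_iff)
    then have "proots ([:-x, 1:] * (\<Prod>x\<in>#A. [:-x, 1:])) = {#x#} + A"
      by (subst proots_mult) (simp_all add: add del: mult_pCons_left)
    then show ?case by (simp del: mult_pCons_left)
  qed simp
  finally have sz: "size (proots P) = q" using A degP by simp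
  have cnt: "count (proots P) x = 1" if "x \<in> set_mset (proots P)" for x
    using that simple_root[of x] P0 by (simp add: order_root le_Suc_eq)
  have "size (proots P) = (\<Sum>x\<in>set_mset (proots P). count (proots P) x)"
    by (simp add: size_multiset_overloaded_eq)
  also have "\<dots> = card (set_mset (proots P))"
    using cnt by simp
  also have "set_mset (proots P) = S"
    using P0 by (simp add: S)
  finally show "card S = q" using sz by simp
  show "x + y \<in> S" if "x \<in> S" "y \<in> S" for x y
    using that unfolding S_def by (simp add: freshmans_dream'[OF p q])
  show "x * y \<in> S" if "x \<in> S" "y \<in> S" for x y
    using that unfolding S_def by (simp add: power_mult_distrib)
qed

definition C4_free_incidence :: "('p \<times> 'l) set \<Rightarrow> bool" where
  "C4_free_incidence I \<longleftrightarrow>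
     (\<forall>p p' l l'. (p, l) \<in> I \<longrightarrow> (p, l') \<in> I \<longrightarrow> (p', l) \<in> I \<longrightarrow> (p', l') \<in> I \<longrightarrow> p = p' \<or> l = l')"

text \<open>The points \<open>(x, y)\<close> and the lines \<open>y = m x + b\<close>: two lines with two common points
  coincide, as \<open>(m - m') (x - x') = 0\<close> in a field.\<close>
lemma affine_plane_incidence:
  fixes S :: "'a :: field set"
  assumes fin: "finite S"
    and add: "\<And>x y. x \<in> S \<Longrightarrow> y \<in> S \<Longrightarrow> x + y \<in> S"
    and mult: "\<And>x y. x \<in> S \<Longrightarrow> y \<in> S \<Longrightarrow> x * y \<in> S"
  obtains I where "I \<subseteq> (S \<times> S) \<times> (S \<times> S)" "C4_free_incidence I" "card I = card S ^ 3"
proof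
  let ?f = "\<lambda>(x, m, b). ((x, m * x + b), (m, b))"
  let ?I = "?f ` (S \<times> S \<times> S)"
  show "?I \<subseteq> (S \<times> S) \<times> (S \<times> S)"
    using add mult by auto
  have "inj_on ?f (S \<times> S \<times> S)"
    by (auto simp: inj_on_def)
  then show "card ?I = card S ^ 3"
    by (simp add: card_image card_cartesian_product power3_eq_cube)
  show "C4_free_incidence ?I"
    unfolding C4_free_incidence_def
  proof (intro allI impI)
    fix p p' l l'
    assume "(p, l) \<in> ?I" "(p, l') \<in> ?I" "(p', l) \<in> ?I" "(p', l') \<in> ?I"
    then obtain x x' m b m' b' where
      eq: "p = (x, m * x + b)" "p' = (x', m * x' + b)" "l = (m, b)" "l' = (m', b')"
        "m * x + b = m' * x + b'" "m * x' + b = m' * x' + b'"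
      by auto
    have "(m - m') * (x - x') = (m * x + b - (m' * x + b')) - (m * x' + b - (m' * x' + b'))"
      by (simp add: algebra_simps)
    also have "\<dots> = 0"
      using eq(5,6) by simp
    finally have "(m - m') * (x - x') = 0" .
    then show "p = p' \<or> l = l'"
      using eq by auto
  qed
qed

lemma ex_C4_free_incidence:
  assumes "k > 0"
  obtains Z :: "(gf2 alg_closure \<times> gf2 alg_closure) set" and I where
    "finite Z" "card Z = (2 ^ k) ^ 2" "I \<subseteq> Z \<times> Z" "C4_free_incidence I" "card I = (2 ^ k) ^ 3"
proof -
  let ?S = "{x :: gf2 alg_closure. x ^ (2 ^ k) = x}"
  have p: "prime CHAR(gf2 alg_closure)" "(2::nat) ^ k = CHAR(gf2 alg_closure) ^ k"
    by (simp_all add: CHAR_gf2)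
  note S = roots_of_frobenius_power[OF p assms]
  obtain I where I: "I \<subseteq> (?S \<times> ?S) \<times> (?S \<times> ?S)" "C4_free_incidence I" "card I = card ?S ^ 3"
    using affine_plane_incidence[OF S(1,3,4)] by blast
  show ?thesis
    by (rule that[of "?S \<times> ?S" I]) (use I S(1,2) in \<open>auto simp: card_cartesian_product power2_eq_square\<close>)
qed

section \<open>The lower bound by coning\<close>

text \<open>The apex \<open>z\<close> lies in every triple, but each base vertex misses two of the four triples of a
  special four cycle. So \<open>z\<close> is the third vertex of all four triples, and the base vertices form a
  four cycle in the bipartite graph of \<open>I\<close>.\<close>
lemma cone_no_special_four_cycle:
  assumes I: "C4_free_incidence I" "I \<subseteq> P \<times> L"
    and inj: "inj_on u P" "inj_on v L" and disj: "u ` P \<inter> v ` L = {}"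
    and z: "z \<notin> u ` P \<union> v ` L"
    and E: "E = (\<lambda>(p, l). {z, u p, v l}) ` I"
    and G: "G \<in> special_four_cycles"
  shows "\<not> contains_copy (V, E) G"
proof
  assume "contains_copy (V, E) G"
  obtain w1 w2 w3 w4 where G: "G = special_four_cycle w1 w2 w3 w4"
    and w: "w1 \<ge> 4" "w2 \<ge> 4" "w3 \<ge> 4" "w4 \<ge> 4"
    using special_four_cyclesE[OF G] by blast
  obtain f where f: "inj_on f {0, 1, 2, 3, w1, w2, w3, w4}"
    and e: "{f w1, f 0, f 1} \<in> E" "{f w2, f 1, f 2} \<in> E" "{f w3, f 2, f 3} \<in> E" "{f w4, f 3, f 0} \<in> E"
    using \<open>contains_copy (V, E) G\<close>
    unfolding contains_copy_def G fst_special_four_cycle snd_special_four_cycle by auto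
  have d: "distinct [f 0, f 1, f 2, f 3]"
    and dw: "\<And>w. w \<in> {w1, w2, w3, w4} \<Longrightarrow> f w \<notin> {f 0, f 1, f 2, f 3}"
    using f w by (auto simp: inj_on_def)
  have zE: "z \<in> e" if "e \<in> E" for e
    using that E by auto
  have nz: "f 0 \<noteq> z" "f 1 \<noteq> z" "f 2 \<noteq> z" "f 3 \<noteq> z"
    using d dw[of w1] dw[of w2] dw[of w3] dw[of w4] e[THEN zE] by auto
  then have "f w1 = z" "f w2 = z" "f w3 = z" "f w4 = z"
    using e[THEN zE] by auto
  define adj where "adj x y \<longleftrightarrow> (\<exists>p l. (p, l) \<in> I \<and> (x = u p \<and> y = v l \<or> x = v l \<and> y = u p))" for x y
  have adj: "adj x y" if xy: "{z, x, y} \<in> E" "x \<noteq> z" "y \<noteq> z" for x y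
  proof -
    obtain p l where pl: "(p, l) \<in> I" and eq: "{z, x, y} = {z, u p, v l}"
      using xy E by auto
    have "{x, y} = {z, x, y} - {z}"
      using xy(2,3) by auto
    also have "\<dots> = {z, u p, v l} - {z}"
      by (simp only: eq)
    also have "\<dots> = {u p, v l}"
      using z I(2) pl by auto
    finally have "{x, y} = {u p, v l}" .
    then show ?thesis
      using pl unfolding adj_def doubleton_eq_iff by blast
  qed
  have C4: "adj (f 0) (f 1)" "adj (f 1) (f 2)" "adj (f 2) (f 3)" "adj (f 3) (f 0)"
    using e \<open>f w1 = z\<close> \<open>f w2 = z\<close> \<open>f w3 = z\<close> \<open>f w4 = z\<close> nz d by (auto intro!: adj)
  have in_I: "p \<in> P \<and> l \<in> L" if "(p, l) \<in> I" for p l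
    using that I(2) by auto
  have u_eq: "u p = u p' \<Longrightarrow> p \<in> P \<Longrightarrow> p' \<in> P \<Longrightarrow> p = p'" for p p'
    using inj(1) by (simp add: inj_on_eq_iff)
  have v_eq: "v l = v l' \<Longrightarrow> l \<in> L \<Longrightarrow> l' \<in> L \<Longrightarrow> l = l'" for l l'
    using inj(2) by (simp add: inj_on_eq_iff)
  have uv_ne: "p \<in> P \<Longrightarrow> l \<in> L \<Longrightarrow> u p \<noteq> v l" for p l
    using disj by blast
  \<comment> \<open>The graph is bipartite, so a four cycle starting at a point alternates point, line, point, line.\<close>
  have bip: False if h: "x0 = u p" "adj x0 x1" "adj x1 x2" "adj x2 x3" "adj x3 x0" "p \<in> P"
      "distinct [x0, x1, x2, x3]" for x0 x1 x2 x3 p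
  proof -
    have *: "\<exists>l. (p, l) \<in> I \<and> y = v l" if "adj (u p) y \<or> adj y (u p)" "p \<in> P" for p y
      using that unfolding adj_def by (metis in_I u_eq uv_ne)
    have **: "\<exists>p. (p, l) \<in> I \<and> y = u p" if "adj (v l) y \<or> adj y (v l)" "l \<in> L" for l y
      using that unfolding adj_def by (metis in_I v_eq uv_ne)
    obtain l1 where l1: "(p, l1) \<in> I" "x1 = v l1" using *[of p x1] h by auto
    obtain l3 where l3: "(p, l3) \<in> I" "x3 = v l3" using *[of p x3] h by auto
    obtain p2 where p2: "(p2, l1) \<in> I" "x2 = u p2" using **[of l1 x2] h l1 I(2) by auto
    obtain l3' where l3': "(p2, l3') \<in> I" "x3 = v l3'" using *[of p2 x3] h p2 I(2) by auto
    have "l3' = l3" using l3 l3' inj(2) I(2) by (auto simp: inj_on_def)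
    then have "p = p2 \<or> l1 = l3"
      using I(1) l1 l3 p2 l3' unfolding C4_free_incidence_def by blast
    then show False using h l1 l3 p2 by auto
  qed
  obtain p l where pl: "(p, l) \<in> I" "f 0 = u p \<and> f 1 = v l \<or> f 0 = v l \<and> f 1 = u p"
    using C4(1) by (auto simp: adj_def)
  then have "p \<in> P" using I(2) by auto
  with pl show False
    using bip[of "f 0" p "f 1" "f 2" "f 3"] bip[of "f 1" p "f 2" "f 3" "f 0"] C4 d by auto
qed

lemma card_incidence_le_ex:
  assumes I: "C4_free_incidence I" "I \<subseteq> P \<times> L"
    and fin: "finite P" "finite L" and n: "card P + card L < n"
    and A: "A \<subseteq> special_four_cycles"
  shows "card I \<le> ex n A"
proof -
  let ?z = "card P + card L"
  obtain u where u: "bij_betw u P {0..<card P}"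
    using ex_bij_betw_finite_nat[OF fin(1)] by blast
  obtain v where v: "bij_betw v L {card P..<?z}"
    using fin(2) by (metis finite_same_card_bij add_diff_cancel_left' card_atLeastLessThan finite_atLeastLessThan)
  have uv: "inj_on u P" "inj_on v L" "u ` P \<inter> v ` L = {}" "?z \<notin> u ` P \<union> v ` L"
    using u v by (auto simp: bij_betw_def)
  let ?t = "\<lambda>(p, l). {?z, u p, v l}"
  let ?E = "?t ` I"
  have ran: "u p < card P" "card P \<le> v l" "v l < ?z" if "(p, l) \<in> I" for p l
    using that I(2) u v by (force simp: bij_betw_def)+
  have "inj_on ?t I"
  proof (rule inj_onI, clarify)
    fix p l p' l' assume *: "(p, l) \<in> I" "(p', l') \<in> I" "{?z, u p, v l} = {?z, u p', v l'}"
    then have "u p \<in> {?z, u p', v l'}" "v l \<in> {?z, u p', v l'}"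
      by blast+
    then have "u p = u p'" "v l = v l'"
      using ran[OF *(1)] ran[OF *(2)] by auto
    then show "p = p' \<and> l = l'"
      using uv(1,2) I(2)[THEN subsetD, OF *(1)] I(2)[THEN subsetD, OF *(2)] by (auto simp: inj_on_def)
  qed
  then have "card I = card (snd ({..<n}, ?E))"
    by (simp add: card_image)
  also have "\<dots> \<le> ex n A"
  proof (rule card_le_ex)
    show "triple_system ({..<n}, ?E)"
    proof -
      have "e \<subseteq> {..<n} \<and> card e = 3" if e: "e \<in> ?E" for e
      proof -
        obtain p l where "(p, l) \<in> I" "e = {?z, u p, v l}"
          using e by auto
        then show ?thesis using ran[of p l] n by auto
      qed
      then show ?thesis
        unfolding triple_system_def fst_conv snd_conv by (intro conjI finite_lessThan ballI) blast+
    qed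
    show "\<not> contains_copy ({..<n}, ?E) G" if "G \<in> A" for G
      by (rule cone_no_special_four_cycle[OF I uv refl]) (use that A in auto)
  qed simp
  finally show ?thesis .
qed

text \<open>With \<open>q = 2 ^ k\<close> the largest power of two such that the cone over the affine plane fits, \<open>n\<close> is
  at most \<open>8 q\<^sup>2\<close>, which makes the \<open>q\<^sup>3\<close> triples at least a constant times \<open>n powr (3 / 2)\<close>.\<close>
lemma ex_lower_bound:
  assumes A: "A \<subseteq> special_four_cycles" and n: "n \<ge> 9"
  shows "real n powr (3 / 2) \<le> 64 * real (ex n A)"
proof -
  define k where "k = (GREATEST k. 2 * 4 ^ k < n)"
  have bd: "k \<le> n" if "2 * 4 ^ k < n" for k
  proof -
    have "k \<le> 2 ^ k" by (simp add: less_imp_le_nat)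
    also have "\<dots> \<le> 4 ^ k" by (intro power_mono) auto
    finally show ?thesis using that by linarith
  qed
  have k: "2 * 4 ^ k < n"
    unfolding k_def by (rule GreatestI_nat[where k = 1 and b = n]) (use n bd in auto)
  have k1: "n \<le> 2 * 4 ^ (k + 1)"
    using Greatest_le_nat[of "\<lambda>k. 2 * 4 ^ k < n" "k + 1" n] bd unfolding k_def[symmetric] by force
  have k0: "k > 0"
    using k1 n by (cases k) auto
  obtain Z :: "(gf2 alg_closure \<times> gf2 alg_closure) set" and I where
    I: "finite Z" "card Z = (2 ^ k) ^ 2" "I \<subseteq> Z \<times> Z" "C4_free_incidence I" "card I = (2 ^ k) ^ 3"
    using ex_C4_free_incidence[OF k0] by blast
  have "card Z + card Z < n"
    using k I(2) by (simp flip: power_mult add: mult.commute[of k] power_mult)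
  then have le: "(2 ^ k) ^ 3 \<le> ex n A"
    using card_incidence_le_ex[OF I(4,3,1,1) _ A] I(5) by simp
  \<comment> \<open>The factor 8 is enlarged to a perfect square, so that the power \<open>3 / 2\<close> stays rational.\<close>
  have "real n \<le> 16 * (2 ^ k) ^ 2"
  proof -
    have "real n \<le> real (2 * 4 ^ (k + 1))" using k1 by (simp only: of_nat_le_iff)
    also have "\<dots> = 8 * (2 ^ k) ^ 2" by (simp flip: power_mult add: mult.commute[of k] power_mult)
    also have "\<dots> \<le> 16 * (2 ^ k) ^ 2" by simp
    finally show ?thesis .
  qed
  then have "real n powr (3 / 2) \<le> (16 * (2 ^ k) ^ 2) powr (3 / 2)"
    by (intro powr_mono2) auto
  also have "(16 * (2 ^ k) ^ 2 :: real) = (4 * 2 ^ k) powr 2"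
    by (simp add: power_mult_distrib)
  also have "\<dots> powr (3 / 2) = (4 * 2 ^ k) powr 3"
    by (subst powr_powr) simp
  also have "\<dots> = 64 * (2 ^ k) ^ 3"
    by (simp add: power_mult_distrib)
  also have "\<dots> \<le> 64 * real (ex n A)"
    using of_nat_mono[OF le, where 'a = real] by simp
  finally show ?thesis .
qed

section \<open>Edge-labelled graphs\<close>

text \<open>The number of coincidences between \<open>f\<close> and \<open>g\<close> is the inner product of their vectors of fibre
  sizes, so \<open>2 a b \<le> a\<^sup>2 + b\<^sup>2\<close> applies to each value.\<close>
lemma card_equal_pairs:
  fixes f g :: "'i \<Rightarrow> 'l"
  assumes fin: "finite N"
  defines "E \<equiv> \<lambda>f g. {(i, j) \<in> N \<times> N. f i = (g j :: 'l)}"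
  shows "2 * card (E f g) \<le> card (E f f) + card (E g g)"
proof -
  let ?L = "f ` N \<union> g ` N"
  let ?n = "\<lambda>f b. card {i \<in> N. f i = b}"
  have E: "card (E f' g') = (\<Sum>b\<in>?L. ?n f' b * ?n g' b)" if "f' ` N \<subseteq> ?L" for f' g'
  proof -
    have "E f' g' = (\<Union>b\<in>?L. {i \<in> N. f' i = b} \<times> {j \<in> N. g' j = b})"
      using that by (fastforce simp: E_def image_subset_iff)
    also have "card \<dots> = (\<Sum>b\<in>?L. card ({i \<in> N. f' i = b} \<times> {j \<in> N. g' j = b}))"
      using fin by (intro card_UN_disjoint) auto
    finally show ?thesis by (simp add: card_cartesian_product)
  qed
  have "2 * a * b \<le> a * a + b * b" for a b :: nat
  proof -
    have "real (2 * a * b) \<le> real (a * a + b * b)"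
      using sum_squares_bound[of "real a" "real b"] by (simp add: power2_eq_square)
    then show ?thesis by (simp only: of_nat_le_iff)
  qed
  then have "(\<Sum>b\<in>?L. 2 * ?n f b * ?n g b) \<le> (\<Sum>b\<in>?L. ?n f b * ?n f b + ?n g b * ?n g b)"
    by (intro sum_mono)
  then show ?thesis
    by (simp add: E sum.distrib sum_distrib_left mult.assoc)
qed

text \<open>Read \<open>N\<close> as the common neighbours of two vertices, and \<open>\<alpha> i\<close>, \<open>\<beta> i\<close> as the labels of the two edges
  at \<open>i\<close>: the hypothesis says that no four cycle through \<open>i\<close> and \<open>j\<close> is rainbow, and \<open>G\<close> collects those
  with two equal labels on adjacent edges. The four cycles outside \<open>G\<close> have equal labels on opposite
  edges, so they are coincidences between \<open>\<alpha>\<close> and \<open>\<beta>\<close>. There are at most as many of those as of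
  coincidences of \<open>\<alpha>\<close> or \<open>\<beta>\<close> with itself, which lie in \<open>G\<close> except for \<open>i = j\<close>.\<close>
lemma many_coincidences:
  fixes \<alpha> \<beta> :: "'i \<Rightarrow> 'l"
  assumes fin: "finite N"
    and nr: "\<And>i j. i \<in> N \<Longrightarrow> j \<in> N \<Longrightarrow> i \<noteq> j \<Longrightarrow> \<not> distinct [\<alpha> i, \<beta> i, \<beta> j, \<alpha> j]"
  defines "G \<equiv> {(i, j) \<in> N \<times> N. i \<noteq> j \<and> (\<alpha> i = \<alpha> j \<or> \<beta> i = \<beta> j \<or> \<alpha> i = \<beta> i \<or> \<alpha> j = \<beta> j)}"
  shows "(card N)\<^sup>2 \<le> 3 * card G + 3 * card N"
proof -
  let ?E = "\<lambda>f g. {(i, j) \<in> N \<times> N. f i = (g j :: 'l)}"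
  let ?Id = "(\<lambda>i. (i, i)) ` N"
  have fins: "finite G" "finite ?Id" "finite (?E f g)" for f g
    unfolding G_def using fin by (auto intro: finite_subset[of _ "N \<times> N"])
  have Id: "card ?Id = card N" by (simp add: card_image inj_on_def)
  have self: "card (?E f f) \<le> card N + card G" if "f = \<alpha> \<or> f = \<beta>" for f
  proof -
    have "?E f f \<subseteq> ?Id \<union> G" using that by (auto simp: G_def)
    then have "card (?E f f) \<le> card (?Id \<union> G)" using fins by (intro card_mono) auto
    also have "\<dots> \<le> card N + card G" using card_Un_le[of ?Id G] Id by simp
    finally show ?thesis .
  qed
  have "N \<times> N \<subseteq> ?Id \<union> G \<union> (?E \<alpha> \<beta> \<union> ?E \<beta> \<alpha>)"
    using nr by (fastforce simp: G_def)
  then have "card (N \<times> N) \<le> card (?Id \<union> G \<union> (?E \<alpha> \<beta> \<union> ?E \<beta> \<alpha>))"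
    using fins by (intro card_mono) auto
  also have "\<dots> \<le> card N + card G + (card (?E \<alpha> \<beta>) + card (?E \<beta> \<alpha>))"
    using card_Un_le[of ?Id G] card_Un_le[of "?E \<alpha> \<beta>" "?E \<beta> \<alpha>"]
      card_Un_le[of "?Id \<union> G" "?E \<alpha> \<beta> \<union> ?E \<beta> \<alpha>"] Id by linarith
  also have "\<dots> \<le> 3 * card G + 3 * card N"
    using card_equal_pairs[OF fin, of \<alpha> \<beta>] card_equal_pairs[OF fin, of \<beta> \<alpha>] self[OF disjI1[OF refl]] self[OF disjI2[OF refl]]
    by linarith
  finally show ?thesis by (simp add: card_cartesian_product power2_eq_square)
qed

text \<open>Count the pairs of a four cycle and a diagonal of it for which two adjacent edges have the same label.
  From below, \<open>many_coincidences\<close> for each diagonal gives at least five times the number of paths of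
  length two, minus \<open>O(n\<^sup>2)\<close>. From above there are at most four times as many as paths: the
  monochromatic path can sit in four places, and in each of them the cycle is determined by the other
  path with the same ends, since the ends determine the monochromatic one by \<open>two_cherries\<close>.\<close>
lemma labelled_graph_bound:
  fixes adj :: "'a \<Rightarrow> 'a \<Rightarrow> bool" and c :: "'a \<Rightarrow> 'a \<Rightarrow> 'l"
  assumes fin: "finite U" and adjU: "\<And>x y. adj x y \<Longrightarrow> x \<in> U"
    and sym: "\<And>x y. adj x y \<Longrightarrow> adj y x" and csym: "\<And>x y. c x y = c y x"
    and rainbow: "\<And>x y x' y'. x \<noteq> x' \<Longrightarrow> y \<noteq> y' \<Longrightarrow> adj x y \<Longrightarrow> adj y x' \<Longrightarrow> adj x' y' \<Longrightarrow> adj y' x \<Longrightarrow>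
        \<not> distinct [c x y, c y x', c x' y', c y' x]"
    and two_cherries: "\<And>x y x' y'. x \<noteq> x' \<Longrightarrow> y \<noteq> y' \<Longrightarrow> adj x y \<Longrightarrow> adj y x' \<Longrightarrow> adj x' y' \<Longrightarrow> adj y' x \<Longrightarrow>
        c x y = c x y' \<Longrightarrow> c x' y \<noteq> c x' y'"
  shows "(card {(x, y). adj x y})\<^sup>2 \<le> 28 * card U ^ 3"
proof -
  define N where "N p = {y. adj (fst p) y \<and> adj (snd p) y}" for p
  define P where "P = {(x, x') \<in> U \<times> U. x \<noteq> x'}"
  define Q where "Q = Sigma P N"
  define good where "good p = {(y, y') \<in> N p \<times> N p. y \<noteq> y' \<and>
    (c (fst p) y = c (fst p) y' \<or> c (snd p) y = c (snd p) y' \<or>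
     c (fst p) y = c (snd p) y \<or> c (fst p) y' = c (snd p) y')}" for p
  define GG where "GG = Sigma P good"
  have adjU2: "y \<in> U" if "adj x y" for x y
    using adjU[OF sym[OF that]] .
  have finN: "finite (N p)" for p
    using fin by (rule finite_subset[rotated]) (auto simp: N_def adjU2)
  have fingood: "finite (good p)" for p
    using finN[of p] by (auto simp: good_def intro: finite_subset[of _ "N p \<times> N p"])
  have finP: "finite P"
    using fin by (auto simp: P_def intro: finite_subset[of _ "U \<times> U"])
  have finQ: "finite Q" unfolding Q_def using finP finN by auto
  have cardP: "card P \<le> (card U)\<^sup>2"
    using card_mono[of "U \<times> U" P] fin by (auto simp: P_def card_cartesian_product power2_eq_square)

  have per_pair: "5 * card (N p) \<le> card (good p) + 27" if p: "p \<in> P" for p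
  proof -
    have "(card (N p))\<^sup>2 \<le> 3 * card (good p) + 3 * card (N p)"
      unfolding good_def
    proof (rule many_coincidences[OF finN])
      fix i j assume ij: "i \<in> N p" "j \<in> N p" "i \<noteq> j"
      then have "adj (fst p) i" "adj i (snd p)" "adj (snd p) j" "adj j (fst p)" "fst p \<noteq> snd p"
        using p sym[of "fst p" j] sym[of "snd p" i] by (auto simp: N_def P_def)
      from rainbow[OF this(5) ij(3) this(1-4)]
      show "\<not> distinct [c (fst p) i, c (snd p) i, c (snd p) j, c (fst p) j]"
        by (simp only: csym[of "snd p" i] csym[of "fst p" j] simp_thms)
    qed
    then have "real ((card (N p))\<^sup>2) \<le> real (3 * card (good p) + 3 * card (N p))"
      by (simp only: of_nat_le_iff)
    then have "(real (card (N p)))\<^sup>2 \<le> 3 * real (card (good p)) + 3 * real (card (N p))"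
      by simp
    \<comment> \<open>The factor 5 must exceed the 4 of the upper count; \<open>t\<^sup>2 \<ge> 18 t - 81\<close> gives exactly that.\<close>
    moreover have "(real (card (N p)))\<^sup>2 \<ge> 18 * real (card (N p)) - 81"
      using zero_le_power2[of "real (card (N p)) - 9"] by (simp add: power2_diff)
    ultimately show ?thesis by linarith
  qed
  have "5 * card Q = (\<Sum>p\<in>P. 5 * card (N p))"
    unfolding Q_def using finP finN by (simp add: card_SigmaI sum_distrib_left)
  also have "\<dots> \<le> (\<Sum>p\<in>P. card (good p) + 27)"
    by (intro sum_mono per_pair)
  also have "\<dots> = card GG + 27 * card P"
    unfolding GG_def using finP fingood by (simp add: card_SigmaI sum.distrib)
  finally have lower: "5 * card Q \<le> card GG + 27 * card P" .

  \<comment> \<open>Both orientations of each edge are listed so that no appeal to symmetry is needed later.\<close>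
  define M where "M R = {((x, x'), (y, y')). x \<noteq> x' \<and> y \<noteq> y' \<and>
    adj x y \<and> adj y x' \<and> adj x' y' \<and> adj y' x \<and>
    adj y x \<and> adj x' y \<and> adj y' x' \<and> adj x y' \<and> R x x' y y'}" for R
  have le_Q: "finite (M R) \<and> card (M R) \<le> card Q" if "inj_on f (M R)" "f ` M R \<subseteq> Q" for f R
    using that finQ by (metis card_inj_on_le finite_subset finite_imageD)
  have uniq: "x = z" if "y \<noteq> y'" "adj x y" "adj y' x" "adj y z" "adj z y'"
      "c x y = c x y'" "c z y = c z y'" for x z y y'
    using two_cherries[of x z y y'] that by blast
  define M1 where "M1 = M (\<lambda>x x' y y'. c x y = c x y')"
  define M2 where "M2 = M (\<lambda>x x' y y'. c x' y = c x' y')"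
  define M3 where "M3 = M (\<lambda>x x' y y'. c y x = c y x')"
  define M4 where "M4 = M (\<lambda>x x' y y'. c y' x = c y' x')"
  \<comment> \<open>In \<open>M1\<close> and \<open>M2\<close> the monochromatic path joins \<open>y\<close> and \<open>y'\<close> and is forgotten; in \<open>M3\<close> and \<open>M4\<close> it
    joins \<open>x\<close> and \<open>x'\<close>.\<close>
  have M1: "finite M1 \<and> card M1 \<le> card Q"
    unfolding M1_def
  proof (rule le_Q)
    show "inj_on (\<lambda>((x, x'), (y, y')). ((y, y'), x')) (M (\<lambda>x x' y y'. c x y = c x y'))"
      by (rule inj_onI) (auto simp: M_def dest: uniq)
    show "(\<lambda>((x, x'), (y, y')). ((y, y'), x')) ` M (\<lambda>x x' y y'. c x y = c x y') \<subseteq> Q"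
      by (auto simp: M_def Q_def P_def N_def adjU)
  qed
  have M2: "finite M2 \<and> card M2 \<le> card Q"
    unfolding M2_def
  proof (rule le_Q)
    show "inj_on (\<lambda>((x, x'), (y, y')). ((y, y'), x)) (M (\<lambda>x x' y y'. c x' y = c x' y'))"
      by (rule inj_onI) (auto simp: M_def dest: uniq)
    show "(\<lambda>((x, x'), (y, y')). ((y, y'), x)) ` M (\<lambda>x x' y y'. c x' y = c x' y') \<subseteq> Q"
      by (auto simp: M_def Q_def P_def N_def adjU)
  qed
  have M3: "finite M3 \<and> card M3 \<le> card Q"
    unfolding M3_def
  proof (rule le_Q)
    show "inj_on (\<lambda>((x, x'), (y, y')). ((x, x'), y')) (M (\<lambda>x x' y y'. c y x = c y x'))"
      by (rule inj_onI) (auto simp: M_def dest: uniq)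
    show "(\<lambda>((x, x'), (y, y')). ((x, x'), y')) ` M (\<lambda>x x' y y'. c y x = c y x') \<subseteq> Q"
      by (auto simp: M_def Q_def P_def N_def adjU)
  qed
  have M4: "finite M4 \<and> card M4 \<le> card Q"
    unfolding M4_def
  proof (rule le_Q)
    show "inj_on (\<lambda>((x, x'), (y, y')). ((x, x'), y)) (M (\<lambda>x x' y y'. c y' x = c y' x'))"
      by (rule inj_onI) (auto simp: M_def dest: uniq)
    show "(\<lambda>((x, x'), (y, y')). ((x, x'), y)) ` M (\<lambda>x x' y y'. c y' x = c y' x') \<subseteq> Q"
      by (auto simp: M_def Q_def P_def N_def adjU)
  qed
  have "GG \<subseteq> (M1 \<union> M2) \<union> (M3 \<union> M4)"
  proof
    fix t assume t: "t \<in> GG"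
    obtain x x' y y' where t_eq: "t = ((x, x'), (y, y'))" by (metis prod.collapse)
    have "x \<noteq> x'" "y \<noteq> y'" and a: "adj x y" "adj x' y" "adj x y'" "adj x' y'"
      and "c x y = c x y' \<or> c x' y = c x' y' \<or> c y x = c y x' \<or> c y' x = c y' x'"
      using t unfolding t_eq by (auto simp: GG_def good_def P_def N_def csym)
    then show "t \<in> (M1 \<union> M2) \<union> (M3 \<union> M4)"
      using a[THEN sym] unfolding t_eq M1_def M2_def M3_def M4_def M_def by simp
  qed
  then have "card GG \<le> card ((M1 \<union> M2) \<union> (M3 \<union> M4))"
    using M1 M2 M3 M4 by (intro card_mono) auto
  also have "\<dots> \<le> 4 * card Q"
    using card_Un_le[of "M1 \<union> M2" "M3 \<union> M4"] card_Un_le[of M1 M2] card_Un_le[of M3 M4] M1 M2 M3 M4 by linarith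
  finally have Q: "card Q \<le> 27 * (card U)\<^sup>2"
    using lower cardP by linarith

  let ?D = "{(x, y). adj x y}"
  define d where "d y = {x. adj x y}" for y
  have find: "finite (d y)" for y
    using fin by (rule finite_subset[rotated]) (auto simp: d_def adjU)
  have D_le: "card ?D \<le> (card U)\<^sup>2" and finD: "finite ?D"
    using card_mono[of "U \<times> U" ?D] finite_subset[of ?D "U \<times> U"] fin adjU adjU2
    by (auto simp: card_cartesian_product power2_eq_square)
  have "?D = (\<lambda>(y, x). (x, y)) ` Sigma U d"
    by (auto simp: d_def adjU2 image_iff)
  then have "card ?D = card (Sigma U d)"
    by (simp add: card_image inj_on_def)
  also have "\<dots> = (\<Sum>y\<in>U. card (d y))"
    using fin find by (simp add: card_SigmaI)
  finally have D: "card ?D = (\<Sum>y\<in>U. card (d y))" .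
  \<comment> \<open>The squared degrees count the paths of length two together with the degenerate ones \<open>x = x'\<close>.\<close>
  have "(\<Sum>y\<in>U. (card (d y))\<^sup>2) = card (SIGMA y:U. d y \<times> d y)"
    using fin find by (simp add: card_SigmaI card_cartesian_product power2_eq_square)
  also have "\<dots> \<le> card ((\<lambda>((x, x'), y). (y, (x, x'))) ` Q \<union> (\<lambda>(x, y). (y, (x, x))) ` ?D)"
    using finQ finD by (intro card_mono) (auto simp: Q_def P_def N_def d_def adjU image_iff)
  also have "\<dots> \<le> card Q + card ?D"
    using card_Un_le card_image_le[OF finQ] card_image_le[OF finD] by (meson add_mono le_trans)
  also have "\<dots> \<le> 28 * (card U)\<^sup>2"
    using Q D_le by linarith
  finally have sq: "(\<Sum>y\<in>U. (card (d y))\<^sup>2) \<le> 28 * (card U)\<^sup>2" .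
  have "(\<Sum>y\<in>U. real (card (d y)))\<^sup>2 \<le> (\<Sum>y\<in>U. (real (card (d y)))\<^sup>2) * card U"
    by (rule sum_squared_le_sum_of_squares)
  then have "(card ?D)\<^sup>2 \<le> (\<Sum>y\<in>U. (card (d y))\<^sup>2) * card U"
    unfolding D by (simp flip: of_nat_sum of_nat_power of_nat_mult)
  also have "\<dots> \<le> 28 * (card U)\<^sup>2 * card U"
    using sq by (rule mult_right_mono) simp
  finally show ?thesis by (simp add: power2_eq_square power3_eq_cube)
qed

section \<open>From triples to edges with labels\<close>

text \<open>If every pair inside a triple were contained in at least six triples, the four cycle \<open>x z y z'\<close>
  coming from two triples \<open>{x, y, z}\<close> and \<open>{x, y, z'}\<close> would extend to a copy of \<open>F1\<close>: the last of the
  four new vertices has to avoid two base vertices and three earlier choices, hence the bound 5.\<close>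
lemma exists_low_codegree_pair:
  assumes H: "triple_system (V, E)" and F1: "\<not> contains_copy (V, E) F1" and ne: "E \<noteq> {}"
  shows "\<exists>q. card q = 2 \<and> card {e \<in> E. q \<subseteq> e} \<le> 5 \<and> {e \<in> E. q \<subseteq> e} \<noteq> {}"
proof (rule ccontr)
  assume high: "\<not> ?thesis"
  have E: "card e = 3" if "e \<in> E" for e
    using H that by (auto simp: triple_system_def)
  have big: "card {e \<in> E. {x, y} \<subseteq> e} \<ge> 6" if "x \<noteq> y" "e \<in> E" "x \<in> e" "y \<in> e" for x y e
  proof -
    have "card {x, y} = 2" "{e \<in> E. {x, y} \<subseteq> e} \<noteq> {}"
      using that by auto
    with high have "\<not> card {e \<in> E. {x, y} \<subseteq> e} \<le> 5" by blast
    then show ?thesis by linarith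
  qed
  have third: "\<exists>w. e = {w, x, y} \<and> w \<noteq> x \<and> w \<noteq> y" if "card e = 3" "{x, y} \<subseteq> e" "x \<noteq> y" for e and x y :: 'a
  proof -
    have "card (e - {x, y}) = 1"
      using that by (subst card_Diff_subset) auto
    then obtain w where "e - {x, y} = {w}" by (auto simp: card_1_singleton_iff)
    then show ?thesis using that by blast
  qed
  have pick: "\<exists>w. {w, x, y} \<in> E \<and> w \<notin> set F \<and> w \<noteq> x \<and> w \<noteq> y"
    if "x \<noteq> y" "e \<in> E" "x \<in> e" "y \<in> e" "length F \<le> 5" for x y e F
  proof (rule ccontr)
    assume none: "\<not> ?thesis"
    have "{e \<in> E. {x, y} \<subseteq> e} \<subseteq> (\<lambda>w. {w, x, y}) ` set F"
    proof
      fix e assume e: "e \<in> {e \<in> E. {x, y} \<subseteq> e}"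
      then obtain w where w: "e = {w, x, y}" "w \<noteq> x" "w \<noteq> y"
        using third[of e x y] E \<open>x \<noteq> y\<close> by blast
      then have "w \<in> set F" using none e by blast
      with w(1) show "e \<in> (\<lambda>w. {w, x, y}) ` set F" by (rule image_eqI)
    qed
    then have "card {e \<in> E. {x, y} \<subseteq> e} \<le> card (set F)"
      by (meson List.finite_set card_image_le card_mono finite_imageI le_trans)
    then show False
      using big[OF that(1-4)] card_length[of F] that(5) by linarith
  qed
  obtain e where e: "e \<in> E" using ne by auto
  then obtain x y z where e_eq: "e = {x, y, z}" "x \<noteq> y" "y \<noteq> z" "x \<noteq> z"
    using E[of e] by (auto simp: card_3_iff)
  obtain z' where z': "{z', x, y} \<in> E" "z' \<noteq> z" "z' \<noteq> x" "z' \<noteq> y"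
    using pick[of x y e "[z]"] e e_eq by force
  obtain w1 where w1: "{w1, x, z} \<in> E" "w1 \<notin> set [y, z']" "w1 \<noteq> x" "w1 \<noteq> z"
    using pick[of x z e "[y, z']"] e e_eq by force
  obtain w2 where w2: "{w2, z, y} \<in> E" "w2 \<notin> set [x, z', w1]" "w2 \<noteq> z" "w2 \<noteq> y"
    using pick[of z y e "[x, z', w1]"] e e_eq by force
  obtain w3 where w3: "{w3, y, z'} \<in> E" "w3 \<notin> set [x, z, w1, w2]" "w3 \<noteq> y" "w3 \<noteq> z'"
    using pick[of y z' "{z', x, y}" "[x, z, w1, w2]"] z' by auto
  obtain w4 where w4: "{w4, z', x} \<in> E" "w4 \<notin> set [y, z, w1, w2, w3]" "w4 \<noteq> z'" "w4 \<noteq> x"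
    using pick[of z' x "{z', x, y}" "[y, z, w1, w2, w3]"] z' by auto
  have "contains_copy (V, E) F1"
    by (rule special_four_cycle_copies(1)[OF H, of w1 x z w2 y w3 z' w4])
      (use w1 w2 w3 w4 z' e_eq in auto)
  with F1 show False ..
qed

lemma contains_copy_mono:
  "contains_copy (V, E') G \<Longrightarrow> E' \<subseteq> E \<Longrightarrow> contains_copy (V, E) G"
  unfolding contains_copy_def fst_conv snd_conv by blast

text \<open>Remove all triples through a pair of low codegree and assign this pair to them, then repeat. The
  remaining triples do not contain the pair, so it is never assigned again.\<close>
lemma exists_own_pairs:
  assumes "triple_system (V, E)" "\<not> contains_copy (V, E) F1"
  shows "\<exists>p. (\<forall>e \<in> E. p e \<subseteq> e \<and> card (p e) = 2) \<and> (\<forall>q. card {e \<in> E. p e = q} \<le> 5)"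
  using assms
proof (induction "card E" arbitrary: E rule: less_induct)
  case less
  have finE: "finite E"
    using less.prems by (auto simp: triple_system_def intro: finite_subset[of _ "Pow V"])
  show ?case
  proof (cases "E = {}")
    case False
    then obtain q where q: "card q = 2" "card {e \<in> E. q \<subseteq> e} \<le> 5" "{e \<in> E. q \<subseteq> e} \<noteq> {}"
      using exists_low_codegree_pair[OF less.prems] by blast
    define E' where "E' = {e \<in> E. \<not> q \<subseteq> e}"
    have "E' \<subset> E" using q(3) by (auto simp: E'_def)
    then have "card E' < card E"
      using finE by (rule psubset_card_mono[rotated])
    moreover have "triple_system (V, E')"
      using less.prems(1) by (simp add: triple_system_def E'_def)
    moreover have "\<not> contains_copy (V, E') F1"
      using less.prems(2) contains_copy_mono \<open>E' \<subset> E\<close> by blast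
    ultimately have IH: "\<exists>p. (\<forall>e \<in> E'. p e \<subseteq> e \<and> card (p e) = 2) \<and> (\<forall>q. card {e \<in> E'. p e = q} \<le> 5)"
      by (rule less.hyps)
    obtain p where p: "\<And>e. e \<in> E' \<Longrightarrow> p e \<subseteq> e \<and> card (p e) = 2" "\<And>r. card {e \<in> E'. p e = r} \<le> 5"
      using IH by blast
    define p' where "p' e = (if q \<subseteq> e then q else p e)" for e
    have "p' e \<subseteq> e \<and> card (p' e) = 2" if "e \<in> E" for e
      using that p(1)[of e] q(1) by (auto simp: p'_def E'_def)
    moreover have "card {e \<in> E. p' e = r} \<le> 5" for r
    proof (cases "r = q")
      case True
      have "{e \<in> E. p' e = r} = {e \<in> E. q \<subseteq> e}"
        using p(1) True by (auto simp: p'_def E'_def)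
      then show ?thesis using q(2) by simp
    next
      case False
      then have "{e \<in> E. p' e = r} = {e \<in> E'. p e = r}"
        by (auto simp: p'_def E'_def)
      then show ?thesis using p(2) by simp
    qed
    ultimately show ?thesis by blast
  qed simp
qed

text \<open>Averaging over all subsets \<open>U\<close> of \<open>V\<close>: a random subset contains \<open>A e\<close> and avoids \<open>B e\<close> with
  probability \<open>1 / 2 ^ k\<close>.\<close>
lemma exists_separating_set:
  assumes fin: "finite V" "finite E"
    and AB: "\<And>e. e \<in> E \<Longrightarrow> A e \<subseteq> V \<and> B e \<subseteq> V \<and> A e \<inter> B e = {} \<and> card (A e \<union> B e) = k"
  shows "\<exists>U\<subseteq>V. card E \<le> 2 ^ k * card {e \<in> E. A e \<subseteq> U \<and> B e \<inter> U = {}}"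
proof (rule ccontr)
  assume few: "\<not> ?thesis"
  let ?ok = "\<lambda>U e. A e \<subseteq> U \<and> B e \<inter> U = {}"
  have less: "2 ^ k * card {e \<in> E. ?ok U e} < card E" if "U \<in> Pow V" for U
    using few that by (meson PowD not_le)
  have many: "2 ^ card V \<le> 2 ^ k * card {U \<in> Pow V. ?ok U e}" if e: "e \<in> E" for e
  proof -
    let ?R = "V - (A e \<union> B e)"
    have k: "card (A e \<union> B e) = k" "A e \<union> B e \<subseteq> V" using AB[OF e] by auto
    then have "k \<le> card V" using fin(1) card_mono by blast
    have "card ?R = card V - k"
      using k fin(1) by (metis card_Diff_subset finite_subset)
    \<comment> \<open>A good \<open>U\<close> is \<open>A e\<close> together with any set of vertices outside \<open>A e\<close> and \<open>B e\<close>.\<close>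
    have "(\<lambda>W. W \<union> A e) ` Pow ?R \<subseteq> {U \<in> Pow V. ?ok U e}"
      using AB[OF e] by blast
    moreover have "inj_on (\<lambda>W. W \<union> A e) (Pow ?R)"
      by (rule inj_on_inverseI[where g = "\<lambda>U. U - A e"]) auto
    ultimately have "card (Pow ?R) \<le> card {U \<in> Pow V. ?ok U e}"
      using fin(1) by (intro card_inj_on_le) auto
    then have "2 ^ (card V - k) \<le> card {U \<in> Pow V. ?ok U e}"
      using fin(1) \<open>card ?R = card V - k\<close> by (simp add: card_Pow)
    then have "2 ^ k * 2 ^ (card V - k) \<le> 2 ^ k * card {U \<in> Pow V. ?ok U e}"
      by simp
    then show ?thesis
      using \<open>k \<le> card V\<close> by (simp flip: power_add)
  qed
  have "card E * 2 ^ card V = (\<Sum>e\<in>E. 2 ^ card V)"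
    by simp
  also have "\<dots> \<le> (\<Sum>e\<in>E. 2 ^ k * card {U \<in> Pow V. ?ok U e})"
    by (intro sum_mono many)
  also have "\<dots> = 2 ^ k * (\<Sum>e\<in>E. \<Sum>U\<in>Pow V. if ?ok U e then 1 else 0)"
    using fin(1) by (simp add: sum_distrib_left sum.If_cases Int_def)
  also have "(\<Sum>e\<in>E. \<Sum>U\<in>Pow V. if ?ok U e then 1 else (0::nat)) = (\<Sum>U\<in>Pow V. \<Sum>e\<in>E. if ?ok U e then 1 else 0)"
    by (rule sum.swap)
  also have "2 ^ k * \<dots> = (\<Sum>U\<in>Pow V. 2 ^ k * card {e \<in> E. ?ok U e})"
    using fin(2) by (simp add: sum_distrib_left sum.If_cases Int_def)
  also have "\<dots> < (\<Sum>U\<in>Pow V. card E)"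
    using fin(1) less by (intro sum_strict_mono) auto
  also have "\<dots> = card E * 2 ^ card V"
    using fin(1) by (simp add: card_Pow)
  finally show False by simp
qed

text \<open>The constant is \<open>40\<^sup>2 * 28\<close>: splitting off \<open>U\<close> costs a factor 8, choosing one triple for each
  own pair a factor 5.\<close>
lemma card_triples_bound:
  fixes V :: "'a set"
  assumes H: "triple_system (V, E)"
    and free: "\<not> contains_copy (V, E) F1" "\<not> contains_copy (V, E) F2" "\<not> contains_copy (V, E) F3"
  shows "(card E)\<^sup>2 \<le> 44800 * card V ^ 3"
proof -
  have finV: "finite V" and EV: "\<And>e. e \<in> E \<Longrightarrow> e \<subseteq> V \<and> card e = 3"
    using H by (auto simp: triple_system_def)
  then have finE: "finite E" by (auto intro: finite_subset[of _ "Pow V"])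
  obtain p where p: "\<And>e. e \<in> E \<Longrightarrow> p e \<subseteq> e \<and> card (p e) = 2" "\<And>q. card {e \<in> E. p e = q} \<le> 5"
    using exists_own_pairs[OF H free(1)] by blast
  have AB: "p e \<subseteq> V \<and> e - p e \<subseteq> V \<and> p e \<inter> (e - p e) = {} \<and> card (p e \<union> (e - p e)) = 3" if "e \<in> E" for e
    using EV[OF that] p(1)[OF that] by (auto simp: Un_absorb1)
  obtain U where U: "U \<subseteq> V" "card E \<le> 2 ^ 3 * card {e \<in> E. p e \<subseteq> U \<and> (e - p e) \<inter> U = {}}"
    using exists_separating_set[OF finV finE, of p "\<lambda>e. e - p e", OF AB] by blast
  define E' where "E' = {e \<in> E. p e \<subseteq> U \<and> (e - p e) \<inter> U = {}}"
  have finE': "finite E'" using finE by (simp add: E'_def)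
  have "card E' \<le> (\<Sum>q\<in>p ` E'. card {e \<in> E'. p e = q})"
    using finE' by (subst card_UN_disjoint[symmetric]) (auto intro!: card_mono)
  also have "\<dots> \<le> (\<Sum>q\<in>p ` E'. 5)"
  proof (rule sum_mono)
    fix q
    have "card {e \<in> E'. p e = q} \<le> card {e \<in> E. p e = q}"
      using finE by (intro card_mono) (auto simp: E'_def)
    then show "card {e \<in> E'. p e = q} \<le> 5" using p(2)[of q] by linarith
  qed
  finally have E'_le: "card E' \<le> 5 * card (p ` E')" by simp

  have "\<exists>w. insert w q \<in> E \<and> w \<notin> U" if q: "q \<in> p ` E'" for q
  proof -
    obtain e where e: "e \<in> E" "q = p e" "(e - p e) \<inter> U = {}"
      using q by (auto simp: E'_def)
    have "card (e - p e) = 1"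
      using EV[OF e(1)] p(1)[OF e(1)] finV by (subst card_Diff_subset) (auto intro: finite_subset)
    then obtain w where "e - p e = {w}" by (auto simp: card_1_singleton_iff)
    moreover from this have "insert w q = e" using p(1)[OF e(1)] e(2) by blast
    ultimately have "insert w q \<in> E" "w \<notin> U" using e(1,3) by blast+
    then show ?thesis by blast
  qed
  then obtain w where w: "\<And>q. q \<in> p ` E' \<Longrightarrow> insert (w q) q \<in> E \<and> w q \<notin> U"
    by metis
  define adj where "adj x y \<longleftrightarrow> x \<noteq> y \<and> {x, y} \<in> p ` E'" for x y
  define c where "c x y = w {x, y}" for x y
  have pU: "q \<subseteq> U \<and> card q = 2" if "q \<in> p ` E'" for q
    using that p(1) by (auto simp: E'_def)
  have adjU: "x \<in> U" if "adj x y" for x y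
    using that pU[of "{x, y}"] by (auto simp: adj_def)
  have sym: "adj y x" if "adj x y" for x y
    using that by (auto simp: adj_def insert_commute)
  have cE: "{c x y, x, y} \<in> E \<and> c x y \<notin> U" if "adj x y" for x y
    using that w[of "{x, y}"] by (auto simp: adj_def c_def)
  have cyc: "\<not> distinct [c x y, c y x', c x' y', c y' x] \<and> \<not> (c y' x = c x y \<and> c y x' = c x' y')"
    if a: "x \<noteq> x'" "y \<noteq> y'" "adj x y" "adj y x'" "adj x' y'" "adj y' x" for x y x' y'
  proof -
    have d: "distinct [x, y, x', y']" using a by (auto simp: adj_def)
    have Us: "x \<in> U" "y \<in> U" "x' \<in> U" "y' \<in> U" using a adjU by auto
    have c: "{c x y, x, y} \<in> snd (V, E)" "{c y x', y, x'} \<in> snd (V, E)"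
      "{c x' y', x', y'} \<in> snd (V, E)" "{c y' x, y', x} \<in> snd (V, E)"
      using cE[OF a(3)] cE[OF a(4)] cE[OF a(5)] cE[OF a(6)] by simp_all
    have "c x y \<notin> U" "c y x' \<notin> U" "c x' y' \<notin> U" "c y' x \<notin> U"
      using cE[OF a(3)] cE[OF a(4)] cE[OF a(5)] cE[OF a(6)] by simp_all
    then have disj: "{c x y, c y x', c x' y', c y' x} \<inter> {x, y, x', y'} = {}"
      using Us by auto
    have disj': "{c y' x, c x y, c y x', c x' y'} \<inter> {y', x, y, x'} = {}"
      using disj by blast
    have d': "distinct [y', x, y, x']"
      using d by auto
    \<comment> \<open>For equal labels on the two edges at \<open>x\<close>, the cycle is read starting from \<open>y'\<close>.\<close>
    note copies = special_four_cycle_copies[OF H]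
    have "\<not> distinct [c x y, c y x', c x' y', c y' x]"
      using copies(1)[OF c d disj] free(1) by blast
    moreover have "\<not> (c y' x = c x y \<and> c y x' = c x' y')"
      using copies(2,3)[OF c(4,1-3) d' disj'] free(2,3) by blast
    ultimately show ?thesis ..
  qed
  have bound: "(card {(x, y). adj x y})\<^sup>2 \<le> 28 * card U ^ 3"
  proof (rule labelled_graph_bound[of U adj c])
    show "finite U" using U(1) finV finite_subset by blast
    show csym: "c x y = c y x" for x y by (simp add: c_def insert_commute)
    fix x y x' y' assume a: "x \<noteq> x'" "y \<noteq> y'" "adj x y" "adj y x'" "adj x' y'" "adj y' x"
    show "\<not> distinct [c x y, c y x', c x' y', c y' x]"
      using cyc[OF a] by blast
    assume "c x y = c x y'"
    then show "c x' y \<noteq> c x' y'"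
      using cyc[OF a] csym[of y' x] csym[of y x'] by metis
  qed (fact adjU sym)+
  have "{(x, y). adj x y} \<subseteq> U \<times> U" using adjU sym by blast
  then have finadj: "finite {(x, y). adj x y}"
    using U(1) finV by (meson finite_SigmaI finite_subset)
  have "p ` E' \<subseteq> (\<lambda>(x, y). {x, y}) ` {(x, y). adj x y}"
  proof
    fix q assume q: "q \<in> p ` E'"
    then obtain x y where "q = {x, y}" "x \<noteq> y"
      using pU[OF q] by (auto simp: card_2_iff)
    with q show "q \<in> (\<lambda>(x, y). {x, y}) ` {(x, y). adj x y}"
      by (auto simp: adj_def)
  qed
  then have "card (p ` E') \<le> card {(x, y). adj x y}"
    using finadj by (meson card_image_le card_mono finite_imageI le_trans)
  then have "card E \<le> 40 * card {(x, y). adj x y}"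
    using U(2) E'_le by (simp flip: E'_def)
  then have "(card E)\<^sup>2 \<le> (40 * card {(x, y). adj x y})\<^sup>2"
    by (rule power_mono) simp
  also have "\<dots> = 1600 * (card {(x, y). adj x y})\<^sup>2"
    by (simp add: power_mult_distrib)
  also have "\<dots> \<le> 1600 * (28 * card U ^ 3)"
    using bound by (rule mult_left_mono) simp
  also have "\<dots> \<le> 44800 * card V ^ 3"
    using card_mono[OF finV U(1)] by (simp add: power_mono)
  finally show ?thesis .
qed

text \<open>The constant is the square root of 44800, rounded up.\<close>
lemma ex_upper_bound:
  assumes A: "{F1, F2, F3} \<subseteq> A" "A \<subseteq> special_four_cycles"
  shows "real (ex n A) \<le> 212 * real n powr (3 / 2)"
proof (rule real_ex_leI)
  show "snd G \<noteq> {}" if G: "G \<in> A" for G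
  proof -
    have "G \<in> special_four_cycles" using G A(2) by blast
    then show ?thesis by (elim special_four_cyclesE) (simp add: snd_special_four_cycle)
  qed
  fix H :: "nat hypergraph"
  assume H: "triple_system H" "card (fst H) = n" "\<And>G. G \<in> A \<Longrightarrow> \<not> contains_copy H G"
  have "(card (snd H))\<^sup>2 \<le> 44800 * n ^ 3"
    using card_triples_bound[of "fst H" "snd H"] H A(1) by simp
  then have "real ((card (snd H))\<^sup>2) \<le> real (44800 * n ^ 3)"
    by (simp only: of_nat_le_iff)
  also have "\<dots> \<le> 212\<^sup>2 * real n ^ 3"
    by simp
  also have "real n ^ 3 = (real n powr (3 / 2)) powr 2"
    by (simp only: powr_powr) simp
  also have "\<dots> = (real n powr (3 / 2))\<^sup>2"
    by simp
  finally have "(real (card (snd H)))\<^sup>2 \<le> (212 * real n powr (3 / 2))\<^sup>2"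
    by (simp add: power_mult_distrib)
  then show "real (card (snd H)) \<le> 212 * real n powr (3 / 2)"
    by (rule power2_le_imp_le) simp
qed

section \<open>The order of magnitude\<close>

lemma ex_bigtheta:
  assumes A: "{F1, F2, F3} \<subseteq> A" "A \<subseteq> special_four_cycles"
  shows "(\<lambda>n. real (ex n A)) \<in> \<Theta>(\<lambda>n. real n powr (3 / 2))"
proof (rule bigthetaI)
  show "(\<lambda>n. real (ex n A)) \<in> O(\<lambda>n. real n powr (3 / 2))"
    using ex_upper_bound[OF A] by (intro bigoI[where c = 212] always_eventually) auto
  have "(\<lambda>n. real n powr (3 / 2)) \<in> O(\<lambda>n. real (ex n A))"
    using ex_lower_bound[OF A(2)]
    by (intro bigoI[where c = 64] eventually_sequentiallyI[where c = 9]) auto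
  then show "(\<lambda>n. real (ex n A)) \<in> \<Omega>(\<lambda>n. real n powr (3 / 2))"
    by (simp add: bigomega_iff_bigo)
qed

theorem mainTheorem2:
  shows "(\<forall>A. {F1, F2, F3} \<subseteq> A \<and> A \<subseteq> special_four_cycles \<longrightarrow>
            (\<lambda>n. real (ex n A)) \<in> \<Theta>(\<lambda>n. real n powr (3 / 2)))
       \<and> card {A. {F1, F2, F3} \<subseteq> A \<and> A \<subseteq> special_four_cycles} = 16
       \<and> (\<lambda>n. real (ex n special_four_cycles)) \<in> \<Theta>(\<lambda>n. real n powr (3 / 2))"
  using ex_bigtheta ex_bigtheta[of special_four_cycles] card_subfamilies
  by (auto simp: special_four_cycles_def)

end
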